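(* (Weak $q$-analogue of Borel–Ritt.) Let $q\in\mathbf{C}$, $|q|>1$, and $\mathbf{E}_q=\mathbf{C}^*/q^{\mathbf{Z}}$. The natural morphism from the sheaf $\mathscr{A}$ on $\mathbf{E}_q$ to the constant sheaf $\mathbf{C}[[z]]$, sending a function to its $q$-asymptotic expansion, is an epimorphism of sheaves.
   Context: $p:\mathbf{C}^*\to\mathbf{E}_q$ is the projection. An open set $U\subset\mathbf{C}^*$ is invariant if $q^{-1}U\subset U$. An invariant strict subset of $U$ is a set $K=\bigcup_{n\ge0}q^{-n}K'$ with $K'\subset U$ compact. A holomorphic function $f$ on an invariant open $U$ is $q$-asymptotic to $\hat f=\sum_{n\ge0}a_nz^n\in\mathbf{C}[[z]]$ if for all $n\in\mathbf{N}$ and every invariant strict subset $K\subset U$, $z^{-n}\bigl(f(z)-\sum_{p<n}a_pz^p\bigr)$ is bounded on $K$ (then $\hat f$ is unique); $\mathscr{A}(U)$ is the $\mathbf{C}$-algebra of holomorphic functions on $U$ admitting a $q$-asymptotic expansion. The sheaf $\mathscr{A}$ on $\mathbf{E}_q$ is defined, for $U_\infty\subset\mathbf{E}_q$ open, by $\mathscr{A}(U_\infty)=\varinjlim\mathscr{A}(U)$, the direct limit (under restriction) over the invariant open $U\subset\mathbf{C}^*$ with $p(U)=U_\infty$. *)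

theory Defs
  imports
    "HOL-Analysis.Analysis"
    "HOL-Computational_Algebra.Formal_Power_Series"
begin

section \<open>Sheaves of sets on a topological space\<close>

record ('x, 's) presheaf_data =
  Sec :: "'x set \<Rightarrow> 's set"
  Res :: "'x set \<Rightarrow> 'x set \<Rightarrow> 's \<Rightarrow> 's"

text \<open>\<open>Res F U V\<close> is the restriction from \<open>U\<close> to \<open>V \<subseteq> U\<close>.\<close>

locale presheaf =
  fixes X :: "'x topology" and F :: "('x, 's) presheaf_data"
  assumes Res_closed:
      "\<lbrakk>openin X U; openin X V; V \<subseteq> U; s \<in> Sec F U\<rbrakk> \<Longrightarrow> Res F U V s \<in> Sec F V"
    and Res_id: "\<lbrakk>openin X U; s \<in> Sec F U\<rbrakk> \<Longrightarrow> Res F U U s = s"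
    and Res_comp:
      "\<lbrakk>openin X U; openin X V; openin X W; W \<subseteq> V; V \<subseteq> U; s \<in> Sec F U\<rbrakk>
        \<Longrightarrow> Res F V W (Res F U V s) = Res F U W s"

text \<open>A covering is given as a set of open sets. The empty covering is allowed, so that a sheaf
  has exactly one section over the empty set.\<close>

locale sheaf = presheaf +
  assumes separation:
      "\<lbrakk>\<And>V. V \<in> \<V> \<Longrightarrow> openin X V; s \<in> Sec F (\<Union>\<V>); t \<in> Sec F (\<Union>\<V>);
        \<And>V. V \<in> \<V> \<Longrightarrow> Res F (\<Union>\<V>) V s = Res F (\<Union>\<V>) V t\<rbrakk> \<Longrightarrow> s = t"
    and gluing:
      "\<lbrakk>\<And>V. V \<in> \<V> \<Longrightarrow> openin X V; \<And>V. V \<in> \<V> \<Longrightarrow> \<sigma> V \<in> Sec F V;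
        \<And>V W. \<lbrakk>V \<in> \<V>; W \<in> \<V>\<rbrakk> \<Longrightarrow> Res F V (V \<inter> W) (\<sigma> V) = Res F W (V \<inter> W) (\<sigma> W)\<rbrakk>
        \<Longrightarrow> \<exists>s\<in>Sec F (\<Union>\<V>). \<forall>V\<in>\<V>. Res F (\<Union>\<V>) V s = \<sigma> V"

locale sheaf_morphism = source: sheaf X F + target: sheaf X G
  for X :: "'x topology" and F :: "('x, 's) presheaf_data" and G :: "('x, 't) presheaf_data" +
  fixes \<phi> :: "'x set \<Rightarrow> 's \<Rightarrow> 't"
  assumes map_closed: "\<lbrakk>openin X U; s \<in> Sec F U\<rbrakk> \<Longrightarrow> \<phi> U s \<in> Sec G U"
    and natural:
      "\<lbrakk>openin X U; openin X V; V \<subseteq> U; s \<in> Sec F U\<rbrakk> \<Longrightarrow> Res G U V (\<phi> U s) = \<phi> V (Res F U V s)"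

text \<open>Right-cancellable morphisms. Test sheaves have sections in the type \<open>'c\<close>, over which
  a definition cannot quantify; a statement about \<open>sheaf_epimorphism TYPE('c)\<close> with \<open>'c\<close> a type
  variable covers all test sheaves. The sheaf of open subsets (\<open>'c = 'x set\<close>) is already enough to
  detect local surjectivity: compare the map sending a section of \<open>G\<close> to the largest open set on
  which it locally lifts to \<open>F\<close> with the map sending it to its whole domain.\<close>

definition sheaf_epimorphism ::
  "'c itself \<Rightarrow> 'x topology \<Rightarrow> ('x, 's) presheaf_data \<Rightarrow> ('x, 't) presheaf_data
    \<Rightarrow> ('x set \<Rightarrow> 's \<Rightarrow> 't) \<Rightarrow> bool" where
  "sheaf_epimorphism _ X F G \<phi> \<longleftrightarrow>
     sheaf_morphism X F G \<phi> \<and>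
     (\<forall>(H :: ('x, 'c) presheaf_data) \<alpha> \<beta>.
        sheaf_morphism X G H \<alpha> \<longrightarrow> sheaf_morphism X G H \<beta> \<longrightarrow>
        (\<forall>U. openin X U \<longrightarrow> (\<forall>s\<in>Sec F U. \<alpha> U (\<phi> U s) = \<beta> U (\<phi> U s))) \<longrightarrow>
        (\<forall>U. openin X U \<longrightarrow> (\<forall>t\<in>Sec G U. \<alpha> U t = \<beta> U t)))"

definition germ ::
  "'x topology \<Rightarrow> ('x, 's) presheaf_data \<Rightarrow> 'x \<Rightarrow> 'x set \<Rightarrow> 's \<Rightarrow> ('x set \<times> 's) set" where
  "germ X F x U s =
     {(V, t). openin X V \<and> x \<in> V \<and> t \<in> Sec F V \<and>
        (\<exists>W. openin X W \<and> x \<in> W \<and> W \<subseteq> U \<inter> V \<and> Res F U W s = Res F V W t)}"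

text \<open>The associated sheaf: families of germs that locally come from sections.\<close>

definition sheafification ::
  "'x topology \<Rightarrow> ('x, 's) presheaf_data \<Rightarrow> ('x, 'x \<Rightarrow> ('x set \<times> 's) set) presheaf_data" where
  "sheafification X F = \<lparr>
     Sec = (\<lambda>U. {\<sigma> \<in> extensional U. \<forall>x\<in>U. \<exists>V s.
              openin X V \<and> x \<in> V \<and> V \<subseteq> U \<and> s \<in> Sec F V \<and> (\<forall>y\<in>V. \<sigma> y = germ X F y V s)}),
     Res = (\<lambda>U V \<sigma>. restrict \<sigma> V) \<rparr>"

text \<open>The constant sheaf with value the whole type \<open>'a\<close>: locally constant functions.\<close>

definition constant_sheaf :: "'x topology \<Rightarrow> ('x, 'x \<Rightarrow> 'a) presheaf_data" where
  "constant_sheaf X = \<lparr>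
     Sec = (\<lambda>U. {c \<in> extensional U. \<forall>x\<in>U. \<exists>V.
              openin X V \<and> x \<in> V \<and> V \<subseteq> U \<and> (\<forall>y\<in>V. c y = c x)}),
     Res = (\<lambda>U V c. restrict c V) \<rparr>"


section \<open>The space \<open>\<complex>\<^sup>*/q\<^sup>\<int>\<close>\<close>

definition q_orbit_rel :: "complex \<Rightarrow> (complex \<times> complex) set" where
  "q_orbit_rel q = {(z, w). z \<noteq> 0 \<and> w \<noteq> 0 \<and> (\<exists>k::int. w = q powi k * z)}"

definition q_proj :: "complex \<Rightarrow> complex \<Rightarrow> complex set" where
  "q_proj q z = q_orbit_rel q `` {z}"

definition E_q :: "complex \<Rightarrow> complex set topology" where
  "E_q q = topology (\<lambda>V. V \<subseteq> (- {0}) // q_orbit_rel q \<and> open {z \<in> - {0}. q_proj q z \<in> V})"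

lemma openin_E_q:
  "openin (E_q q) V \<longleftrightarrow>
     V \<subseteq> (- {0}) // q_orbit_rel q \<and> open {z \<in> - {0}. q_proj q z \<in> V}"
proof -
  let ?pre = "\<lambda>V. {z \<in> - {0}. q_proj q z \<in> V}"
  have "istopology (\<lambda>V. V \<subseteq> (- {0}) // q_orbit_rel q \<and> open (?pre V))"
    unfolding istopology_def
  proof (intro conjI allI impI)
    fix S T
    assume "S \<subseteq> (- {0}) // q_orbit_rel q \<and> open (?pre S)"
      and "T \<subseteq> (- {0}) // q_orbit_rel q \<and> open (?pre T)"
    moreover have "?pre (S \<inter> T) = ?pre S \<inter> ?pre T" by auto
    ultimately show "S \<inter> T \<subseteq> (- {0}) // q_orbit_rel q" "open (?pre (S \<inter> T))"
      by auto
  next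
    fix \<K>
    assume \<K>: "\<forall>K\<in>\<K>. K \<subseteq> (- {0}) // q_orbit_rel q \<and> open (?pre K)"
    then show "\<Union>\<K> \<subseteq> (- {0}) // q_orbit_rel q" by blast
    have "?pre (\<Union>\<K>) = (\<Union>K\<in>\<K>. ?pre K)" by auto
    with \<K> show "open (?pre (\<Union>\<K>))" by auto
  qed
  then show ?thesis
    unfolding E_q_def by (simp add: topology_inverse')
qed

lemma topspace_E_q: "topspace (E_q q) = (- {0}) // q_orbit_rel q"
proof
  show "topspace (E_q q) \<subseteq> (- {0}) // q_orbit_rel q"
    using openin_topspace[of "E_q q"] unfolding openin_E_q by blast
  have "{z \<in> - {0}. q_proj q z \<in> (- {0}) // q_orbit_rel q} = - {0}"
    unfolding q_proj_def by (auto intro: quotientI)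
  then have "openin (E_q q) ((- {0}) // q_orbit_rel q)"
    unfolding openin_E_q by (simp add: open_Compl)
  then show "(- {0}) // q_orbit_rel q \<subseteq> topspace (E_q q)"
    by (rule openin_subset)
qed

lemma quotient_map_q_proj: "quotient_map (top_of_set (- {0})) (E_q q) (q_proj q)"
  unfolding quotient_map_def topspace_E_q
proof (intro conjI allI impI)
  show "q_proj q ` topspace (top_of_set (- {0})) = (- {0}) // q_orbit_rel q"
    unfolding q_proj_def quotient_def by auto
next
  fix V
  assume "V \<subseteq> (- {0}) // q_orbit_rel q"
  then show "openin (top_of_set (- {0})) {x \<in> topspace (top_of_set (- {0})). q_proj q x \<in> V}
      = openin (E_q q) V"
    unfolding openin_E_q by (subst openin_open_eq) (auto simp: open_Compl)
qed


section \<open>\<open>q\<close>-asymptotic expansions\<close>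

definition invariant_open :: "complex \<Rightarrow> complex set \<Rightarrow> bool" where
  "invariant_open q U \<longleftrightarrow> open U \<and> 0 \<notin> U \<and> (\<lambda>z. z / q) ` U \<subseteq> U"

definition invariant_strict_subset :: "complex \<Rightarrow> complex set \<Rightarrow> complex set \<Rightarrow> bool" where
  "invariant_strict_subset q U K \<longleftrightarrow>
     (\<exists>K'. compact K' \<and> K' \<subseteq> U \<and> K = (\<Union>n::nat. (\<lambda>z. z / q ^ n) ` K'))"

definition q_asymptotic :: "complex \<Rightarrow> complex set \<Rightarrow> (complex \<Rightarrow> complex) \<Rightarrow> complex fps \<Rightarrow> bool" where
  "q_asymptotic q U f a \<longleftrightarrow>
     (\<forall>n K. invariant_strict_subset q U K \<longrightarrow>
        bounded ((\<lambda>z. (f z - (\<Sum>p<n. fps_nth a p * z ^ p)) / z ^ n) ` K))"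

definition q_asym_functions :: "complex \<Rightarrow> complex set \<Rightarrow> (complex \<Rightarrow> complex) set" where
  "q_asym_functions q U =
     {f \<in> extensional U. f holomorphic_on U \<and> (\<exists>a. q_asymptotic q U f a)}"


section \<open>The sheaf of germs at \<open>0\<close> and the expansion morphism\<close>

text \<open>The direct limit over the invariant open sets \<open>U\<close> with image \<open>V\<close> in \<open>\<complex>\<^sup>*/q\<^sup>\<int>\<close>, as the
  quotient of the pairs \<open>(U, f)\<close> by equality after restriction.\<close>

definition invariant_over :: "complex \<Rightarrow> complex set set \<Rightarrow> complex set set" where
  "invariant_over q V = {U. invariant_open q U \<and> q_proj q ` U = V}"

definition q_asym_pairs ::
  "complex \<Rightarrow> complex set set \<Rightarrow> (complex set \<times> (complex \<Rightarrow> complex)) set" where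
  "q_asym_pairs q V = Sigma (invariant_over q V) (q_asym_functions q)"

definition q_asym_rel ::
  "complex \<Rightarrow> complex set set \<Rightarrow>
    ((complex set \<times> (complex \<Rightarrow> complex)) \<times> (complex set \<times> (complex \<Rightarrow> complex))) set" where
  "q_asym_rel q V =
     {((U, f), (U', f')). (U, f) \<in> q_asym_pairs q V \<and> (U', f') \<in> q_asym_pairs q V \<and>
        (\<exists>W \<in> invariant_over q V. W \<subseteq> U \<inter> U' \<and> restrict f W = restrict f' W)}"

type_synonym q_asym_class = "(complex set \<times> (complex \<Rightarrow> complex)) set"

text \<open>The restriction to \<open>V'\<close> of the class of \<open>(U, f)\<close> is the class of the restriction of \<open>f\<close> to
  \<open>U \<inter> p\<^sup>-\<^sup>1(V')\<close>; the union below ranges over equal classes.\<close>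

definition q_asym_presheaf :: "complex \<Rightarrow> (complex set, q_asym_class) presheaf_data" where
  "q_asym_presheaf q = \<lparr>
     Sec = (\<lambda>V. q_asym_pairs q V // q_asym_rel q V),
     Res = (\<lambda>V V' c. \<Union>(U, f)\<in>c.
              q_asym_rel q V' `` {(U \<inter> q_proj q -` V', restrict f (U \<inter> q_proj q -` V'))}) \<rparr>"

text \<open>The direct limits only form a presheaf: over a disconnected open set, functions with different
  expansions on the components do not glue to a function with a single expansion. The sheaf
  they define is therefore the associated sheaf.\<close>

definition q_asym_sheaf ::
  "complex \<Rightarrow>
    (complex set, complex set \<Rightarrow> (complex set set \<times> q_asym_class) set) presheaf_data" where
  "q_asym_sheaf q = sheafification (E_q q) (q_asym_presheaf q)"

text \<open>The expansion of a section over a nonempty open set (over the empty set it is not unique),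
  and of a germ.\<close>

definition q_expansion :: "complex \<Rightarrow> q_asym_class \<Rightarrow> complex fps" where
  "q_expansion q c = (THE a. \<exists>(U, f)\<in>c. q_asymptotic q U f a)"

definition q_germ_expansion ::
  "complex \<Rightarrow> (complex set set \<times> q_asym_class) set \<Rightarrow> complex fps" where
  "q_germ_expansion q g = (THE a. \<exists>(V, c)\<in>g. a = q_expansion q c)"

definition q_expansion_morphism ::
  "complex \<Rightarrow> complex set set \<Rightarrow> (complex set \<Rightarrow> (complex set set \<times> q_asym_class) set)
    \<Rightarrow> (complex set \<Rightarrow> complex fps)" where
  "q_expansion_morphism q V \<sigma> = (\<lambda>x\<in>V. q_germ_expansion q (\<sigma> x))"

end

theory Submission
  imports Defs
begin

text \<open>Local surjectivity suffices, since test morphisms into a sheaf can be compared locally.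
  Over the image of a small disc \<open>D\<close> one may take for the invariant open set the union of the
  discs \<open>D / q ^ k\<close>. These are pairwise disjoint, so a holomorphic function can be prescribed
  independently on each of them. Given a formal power series, take on \<open>D / q ^ k\<close> its truncation
  at order \<open>N k\<close>, where \<open>N k\<close> tends to infinity so slowly that the sum of the absolute values of
  the first \<open>N k\<close> coefficients stays below \<open>norm q ^ k\<close>; then every remainder is dominated by
  its first term.\<close>

section \<open>Generalities on sheaves\<close>

text \<open>Common source of \<open>sheafification\<close> and \<open>constant_sheaf\<close>.
  Sections are only required to satisfy \<open>P\<close> near each point, so they glue although
  \<open>P\<close> itself need not glue; what \<open>P\<close> must satisfy is stability under
  shrinking the open set and dependence on nothing but the values there.\<close>

lemma sheaf_of_local_functions:
  fixes X :: "'x topology" and P :: "'x set \<Rightarrow> ('x \<Rightarrow> 'b) \<Rightarrow> bool"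
  assumes mono: "\<And>U V c. \<lbrakk>openin X U; openin X V; V \<subseteq> U; P U c\<rbrakk> \<Longrightarrow> P V c"
    and cong: "\<And>U c d. \<lbrakk>\<And>x. x \<in> U \<Longrightarrow> c x = d x; P U c\<rbrakk> \<Longrightarrow> P U d"
  defines "F \<equiv> \<lparr>Sec = (\<lambda>U. {c \<in> extensional U. \<forall>x\<in>U. \<exists>V.
              openin X V \<and> x \<in> V \<and> V \<subseteq> U \<and> P V c}),
              Res = (\<lambda>U V c. restrict c V)\<rparr>"
  shows "sheaf X F"
proof
  fix U V s
  assume U: "openin X U" and V: "openin X V" and VU: "V \<subseteq> U" and s: "s \<in> Sec F U"
  show "Res F U V s \<in> Sec F V"
    unfolding F_def
  proof (simp, intro ballI)
    fix x assume "x \<in> V"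
    from s have "\<forall>x\<in>U. \<exists>W. openin X W \<and> x \<in> W \<and> W \<subseteq> U \<and> P W s"
      unfolding F_def by simp
    with VU \<open>x \<in> V\<close> obtain W where W: "openin X W" "x \<in> W" "W \<subseteq> U" "P W s"
      by blast
    have "P (W \<inter> V) s"
      using mono[OF W(1) _ _ W(4), of "W \<inter> V"] W(1) V by auto
    then have "P (W \<inter> V) (restrict s V)"
      by (rule cong[rotated]) auto
    with W V \<open>x \<in> V\<close> show "\<exists>W. openin X W \<and> x \<in> W \<and> W \<subseteq> V \<and> P W (restrict s V)"
      by (intro exI[of _ "W \<inter> V"]) auto
  qed
next
  fix U s
  assume "openin X U" "s \<in> Sec F U"
  then show "Res F U U s = s"
    unfolding F_def by (simp add: extensional_restrict)
next
  fix U V W :: "'x set" and s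
  assume "W \<subseteq> V" "V \<subseteq> U"
  then show "Res F V W (Res F U V s) = Res F U W s"
    unfolding F_def by (simp add: inf.absorb2)
next
  fix \<V> s t
  assume st: "s \<in> Sec F (\<Union>\<V>)" "t \<in> Sec F (\<Union>\<V>)"
    and eq: "\<And>V. V \<in> \<V> \<Longrightarrow> Res F (\<Union>\<V>) V s = Res F (\<Union>\<V>) V t"
  show "s = t"
  proof (rule extensionalityI[of _ "\<Union>\<V>"])
    fix x assume "x \<in> \<Union>\<V>"
    then obtain V where "V \<in> \<V>" "x \<in> V" by blast
    with eq[of V] show "s x = t x"
      unfolding F_def by simp (metis restrict_apply')
  qed (use st in \<open>auto simp: F_def\<close>)
next
  fix \<V> \<sigma>
  assume op: "\<And>V. V \<in> \<V> \<Longrightarrow> openin X V"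
    and \<sigma>: "\<And>V. V \<in> \<V> \<Longrightarrow> \<sigma> V \<in> Sec F V"
    and eq: "\<And>V W. \<lbrakk>V \<in> \<V>; W \<in> \<V>\<rbrakk> \<Longrightarrow> Res F V (V \<inter> W) (\<sigma> V) = Res F W (V \<inter> W) (\<sigma> W)"
  \<comment> \<open>The chosen member of the covering is immaterial: compatibility on overlaps gives
    \<open>s_eq\<close>.\<close>
  define s where "s = (\<lambda>x\<in>\<Union>\<V>. \<sigma> (SOME V. V \<in> \<V> \<and> x \<in> V) x)"
  have s_eq: "s x = \<sigma> V x" if "V \<in> \<V>" "x \<in> V" for V x
  proof -
    define W where "W = (SOME V. V \<in> \<V> \<and> x \<in> V)"
    have W: "W \<in> \<V> \<and> x \<in> W"
      unfolding W_def by (rule someI) (use that in blast)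
    have "restrict (\<sigma> V) (V \<inter> W) x = restrict (\<sigma> W) (V \<inter> W) x"
      using eq[of V W] that W unfolding F_def by simp
    with that W show ?thesis
      unfolding s_def W_def by auto
  qed
  show "\<exists>s\<in>Sec F (\<Union>\<V>). \<forall>V\<in>\<V>. Res F (\<Union>\<V>) V s = \<sigma> V"
  proof (intro bexI ballI)
    fix V assume V: "V \<in> \<V>"
    show "Res F (\<Union>\<V>) V s = \<sigma> V"
      by (rule extensionalityI[of _ V]) (use V \<sigma>[of V] s_eq in \<open>auto simp: F_def\<close>)
  next
    show "s \<in> Sec F (\<Union>\<V>)"
      unfolding F_def
    proof (simp, intro conjI ballI)
      show "s \<in> extensional (\<Union>\<V>)" by (simp add: s_def)
    next
      fix V x assume V: "V \<in> \<V>" "x \<in> V"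
      with \<sigma>[of V] obtain W where W: "openin X W" "x \<in> W" "W \<subseteq> V" "P W (\<sigma> V)"
        unfolding F_def by auto
      have "P W s"
        by (rule cong[OF _ W(4)]) (use s_eq V W in auto)
      with W V show "\<exists>W. openin X W \<and> x \<in> W \<and> W \<subseteq> \<Union>\<V> \<and> P W s"
        by blast
    qed
  qed
qed

context presheaf
begin

text \<open>An agreement on \<open>W\<close> can always be tested on the smaller
  \<open>V \<inter> W\<close>. With this, the property of being given by the germs of one section is
  stable under shrinking, as \<open>sheaf_of_local_functions\<close> demands.\<close>

lemma germ_Res:
  assumes U: "openin X U" and V: "openin X V" "V \<subseteq> U" "x \<in> V" and s: "s \<in> Sec F U"
  shows "germ X F x V (Res F U V s) = germ X F x U s"
proof -
  have "(\<exists>W. openin X W \<and> x \<in> W \<and> W \<subseteq> V \<inter> V' \<and> Res F V W (Res F U V s) = Res F V' W t)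
      \<longleftrightarrow> (\<exists>W. openin X W \<and> x \<in> W \<and> W \<subseteq> U \<inter> V' \<and> Res F U W s = Res F V' W t)"
    (is "?L \<longleftrightarrow> ?R")
    if V': "openin X V'" and t: "t \<in> Sec F V'" for V' t
  proof
    assume ?L
    then obtain W where "openin X W" "x \<in> W" "W \<subseteq> V \<inter> V'"
      "Res F V W (Res F U V s) = Res F V' W t" by blast
    with Res_comp[OF U V(1) _ _ V(2) s, of W] V show ?R
      by (intro exI[of _ W]) auto
  next
    assume ?R
    then obtain W where W: "openin X W" "x \<in> W" "W \<subseteq> U \<inter> V'" "Res F U W s = Res F V' W t"
      by blast
    have VW: "openin X (V \<inter> W)" using V W by auto
    have "Res F V (V \<inter> W) (Res F U V s) = Res F W (V \<inter> W) (Res F U W s)"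
      using Res_comp[OF U V(1) VW _ V(2) s] Res_comp[OF U W(1) VW _ _ s] W by auto
    also have "\<dots> = Res F V' (V \<inter> W) t"
      unfolding W(4) using Res_comp[OF V' W(1) VW _ _ t] W by auto
    finally show ?L
      using VW V W by (intro exI[of _ "V \<inter> W"]) auto
  qed
  then show ?thesis
    unfolding germ_def by auto
qed

lemma sheaf_sheafification: "sheaf X (sheafification X F)"
proof -
  define P where "P = (\<lambda>V \<sigma>. \<exists>s \<in> Sec F V. \<forall>y\<in>V. \<sigma> y = germ X F y V s)"
  have "sheaf X \<lparr>Sec = (\<lambda>U. {c \<in> extensional U. \<forall>x\<in>U. \<exists>V.
              openin X V \<and> x \<in> V \<and> V \<subseteq> U \<and> P V c}), Res = (\<lambda>U V c. restrict c V)\<rparr>"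
  proof (rule sheaf_of_local_functions)
    fix U V c
    assume UV: "openin X U" "openin X V" "V \<subseteq> U" and "P U c"
    then obtain s where "s \<in> Sec F U" "\<forall>y\<in>U. c y = germ X F y U s"
      unfolding P_def by blast
    with UV show "P V c"
      unfolding P_def by (intro bexI[of _ "Res F U V s"]) (auto simp: germ_Res Res_closed)
  qed (auto simp: P_def)
  moreover have "\<dots> = sheafification X F"
    unfolding sheafification_def P_def by (simp add: Bex_def conj_assoc)
  ultimately show ?thesis by simp
qed

end

lemma sheaf_constant_sheaf: "sheaf X (constant_sheaf X)"
proof -
  \<comment> \<open>The predicate must not mention the point \<open>x\<close>, so the constant is
    existentially quantified; since \<open>x \<in> V\<close>, it can only be
    \<open>c x\<close>.\<close>
  define P where "P = (\<lambda>V (c :: 'a \<Rightarrow> 'b). \<exists>a. \<forall>y\<in>V. c y = a)"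
  have "sheaf X \<lparr>Sec = (\<lambda>U. {c \<in> extensional U. \<forall>x\<in>U. \<exists>V.
              openin X V \<and> x \<in> V \<and> V \<subseteq> U \<and> P V c}), Res = (\<lambda>U V c. restrict c V)\<rparr>"
    by (rule sheaf_of_local_functions) (auto simp: P_def)
  moreover have "x \<in> V \<Longrightarrow> P V c \<longleftrightarrow> (\<forall>y\<in>V. c y = c x)" for x V c
    unfolding P_def by auto
  then have "\<lparr>Sec = (\<lambda>U. {c \<in> extensional U. \<forall>x\<in>U. \<exists>V.
              openin X V \<and> x \<in> V \<and> V \<subseteq> U \<and> P V c}), Res = (\<lambda>U V c. restrict c V)\<rparr>
      = constant_sheaf X"
    unfolding constant_sheaf_def by (auto cong: conj_cong)
  ultimately show ?thesis by simp
qed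

text \<open>On the open sets where \<open>t\<close> lifts, \<alpha> and \<beta> agree on it by
  assumption and naturality. These sets cover \<open>U\<close>, and separation in the target
  \<open>H\<close> gives equality on \<open>U\<close>.\<close>

lemma sheaf_epimorphism_if_locally_surjective:
  assumes \<phi>: "sheaf_morphism X F G \<phi>"
    and lift: "\<And>U t x. \<lbrakk>openin X U; t \<in> Sec G U; x \<in> U\<rbrakk> \<Longrightarrow>
      \<exists>V s. openin X V \<and> x \<in> V \<and> V \<subseteq> U \<and> s \<in> Sec F V \<and> \<phi> V s = Res G U V t"
  shows "sheaf_epimorphism TYPE('c) X F G \<phi>"
  unfolding sheaf_epimorphism_def
proof (intro conjI allI impI ballI)
  fix H :: "('a, 'c) presheaf_data" and \<alpha> \<beta> U t
  assume \<alpha>: "sheaf_morphism X G H \<alpha>" and \<beta>: "sheaf_morphism X G H \<beta>"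
    and eq: "\<forall>U. openin X U \<longrightarrow> (\<forall>s\<in>Sec F U. \<alpha> U (\<phi> U s) = \<beta> U (\<phi> U s))"
    and U: "openin X U" and t: "t \<in> Sec G U"
  interpret \<alpha>: sheaf_morphism X G H \<alpha> by fact
  interpret \<beta>: sheaf_morphism X G H \<beta> by fact
  define \<V> where "\<V> = {V. openin X V \<and> V \<subseteq> U \<and> Res H U V (\<alpha> U t) = Res H U V (\<beta> U t)}"
  have "x \<in> \<Union>\<V>" if x: "x \<in> U" for x
  proof -
    obtain V s where V: "openin X V" "x \<in> V" "V \<subseteq> U" "s \<in> Sec F V" "\<phi> V s = Res G U V t"
      using lift[OF U t x] by blast
    then have "Res H U V (\<alpha> U t) = Res H U V (\<beta> U t)"
      using \<alpha>.natural[OF U V(1,3) t] \<beta>.natural[OF U V(1,3) t] eq by metis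
    with V show ?thesis unfolding \<V>_def by blast
  qed
  then have \<V>: "\<Union>\<V> = U" unfolding \<V>_def by blast
  show "\<alpha> U t = \<beta> U t"
    by (rule \<alpha>.target.separation[of \<V>])
       (use U t \<alpha>.map_closed \<beta>.map_closed in \<open>auto simp: \<V>, auto simp: \<V>_def\<close>)
qed (fact \<phi>)


section \<open>The orbit space and invariant open sets\<close>

context
  fixes q :: complex
  assumes q: "1 < norm q"
begin

lemma q_nonzero: "q \<noteq> 0"
  using q by auto

lemma equiv_q_orbit_rel: "equiv (- {0}) (q_orbit_rel q)"
proof (rule equivI)
  show "refl_on (- {0}) (q_orbit_rel q)"
    unfolding refl_on_def q_orbit_rel_def by (auto intro: exI[of _ 0])
  show "q_orbit_rel q \<subseteq> (- {0}) \<times> (- {0})"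
    unfolding q_orbit_rel_def by auto
  show "sym (q_orbit_rel q)"
  proof (rule symI)
    fix x y assume "(x, y) \<in> q_orbit_rel q"
    then obtain k where "x \<noteq> 0" "y = q powi k * x" "y \<noteq> 0"
      unfolding q_orbit_rel_def by auto
    with q_nonzero show "(y, x) \<in> q_orbit_rel q"
      unfolding q_orbit_rel_def by (auto intro!: exI[of _ "- k"] simp: power_int_minus)
  qed
  show "trans (q_orbit_rel q)"
  proof (rule transI)
    fix x y z assume "(x, y) \<in> q_orbit_rel q" "(y, z) \<in> q_orbit_rel q"
    then obtain j k where "x \<noteq> 0" "y = q powi j * x" "z = q powi k * y" "z \<noteq> 0"
      unfolding q_orbit_rel_def by blast
    with q_nonzero show "(x, z) \<in> q_orbit_rel q"
      unfolding q_orbit_rel_def by (auto intro!: exI[of _ "k + j"] simp: power_int_add)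
  qed
qed

lemma q_proj_eq_iff:
  assumes "z \<noteq> 0" "w \<noteq> 0"
  shows "q_proj q z = q_proj q w \<longleftrightarrow> (\<exists>k::int. w = q powi k * z)"
  unfolding q_proj_def using eq_equiv_class_iff[OF equiv_q_orbit_rel, of z w] assms
  by (auto simp: q_orbit_rel_def)

lemma q_proj_divide_power:
  assumes "z \<noteq> 0"
  shows "q_proj q (z / q ^ n) = q_proj q z"
  using assms q_nonzero
  by (subst q_proj_eq_iff) (auto intro!: exI[of _ "int n"])

lemma invariant_openD:
  assumes "invariant_open q U" "z \<in> U"
  shows "z \<noteq> 0" "z / q ^ n \<in> U"
proof -
  show "z \<noteq> 0" using assms unfolding invariant_open_def by auto
  show "z / q ^ n \<in> U"
  proof (induction n)
    case (Suc n)
    then have "z / q ^ n / q \<in> U"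
      using assms unfolding invariant_open_def by blast
    then show ?case by (simp add: mult.commute)
  qed (use assms in simp)
qed

text \<open>The projection is open: the saturation of \<open>U\<close> is the union of its preimages
  under the dilations by integer powers of \<open>q\<close>.\<close>

lemma openin_q_proj_image:
  assumes "open U" "0 \<notin> U"
  shows "openin (E_q q) (q_proj q ` U)"
  unfolding openin_E_q
proof
  show "q_proj q ` U \<subseteq> (- {0}) // q_orbit_rel q"
    using assms unfolding q_proj_def by (auto intro!: quotientI)
  have "{z \<in> - {0}. q_proj q z \<in> q_proj q ` U} = (\<Union>k::int. (\<lambda>z. q powi k * z) -` U)"
  proof (intro equalityI subsetI)
    fix z assume z: "z \<in> {z \<in> - {0}. q_proj q z \<in> q_proj q ` U}"
    then obtain u where u: "u \<in> U" "q_proj q z = q_proj q u" by auto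
    with assms z obtain k where "u = q powi k * z"
      using q_proj_eq_iff[of z u] by auto
    with u show "z \<in> (\<Union>k::int. (\<lambda>z. q powi k * z) -` U)" by auto
  next
    fix z assume "z \<in> (\<Union>k::int. (\<lambda>z. q powi k * z) -` U)"
    then obtain k where k: "q powi k * z \<in> U" by auto
    with assms have "z \<noteq> 0" by auto
    moreover from this have "q_proj q z = q_proj q (q powi k * z)"
      using q_nonzero by (subst q_proj_eq_iff) auto
    ultimately show "z \<in> {z \<in> - {0}. q_proj q z \<in> q_proj q ` U}" using k by auto
  qed
  also have "open \<dots>"
    by (intro open_UN ballI open_vimage assms continuous_intros)
  finally show "open {z \<in> - {0}. q_proj q z \<in> q_proj q ` U}" .
qed

lemma invariant_over_Int_vimage:
  assumes U: "U \<in> invariant_over q V" and V': "openin (E_q q) V'" "V' \<subseteq> V"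
  shows "U \<inter> q_proj q -` V' \<in> invariant_over q V'"
proof -
  have inv: "invariant_open q U" and img: "q_proj q ` U = V"
    using U unfolding invariant_over_def by auto
  \<comment> \<open>Since \<open>U\<close> avoids 0, the full preimage may be replaced by the one in
    \<complex> without 0, which is open by the definition of the topology of
    \<open>E_q\<close>.\<close>
  have "U \<inter> q_proj q -` V' = U \<inter> {z \<in> - {0}. q_proj q z \<in> V'}"
    using invariant_openD[OF inv] by auto
  then have "open (U \<inter> q_proj q -` V')"
    using inv V' unfolding openin_E_q invariant_open_def by auto
  moreover have "z / q \<in> U \<inter> q_proj q -` V'" if "z \<in> U \<inter> q_proj q -` V'" for z
    using invariant_openD(2)[OF inv, of z 1] q_proj_divide_power[of z 1]
      invariant_openD(1)[OF inv, of z] that by auto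
  moreover have "q_proj q ` (U \<inter> q_proj q -` V') = V'"
    using img V' by auto
  ultimately show ?thesis
    using inv unfolding invariant_over_def invariant_open_def by auto
qed

text \<open>Of two points of an orbit, one is a backward iterate of the other; so the intersection of
  two invariant sets still meets every orbit that both of them meet.\<close>

lemma invariant_over_Int:
  assumes "U \<in> invariant_over q V" "W \<in> invariant_over q V"
  shows "U \<inter> W \<in> invariant_over q V"
proof -
  have U: "invariant_open q U" "q_proj q ` U = V" and W: "invariant_open q W" "q_proj q ` W = V"
    using assms unfolding invariant_over_def by auto
  have "x \<in> q_proj q ` (U \<inter> W)" if "x \<in> V" for x
  proof -
    from that U W obtain u w where u: "u \<in> U" "x = q_proj q u" and w: "w \<in> W" "x = q_proj q w"
      by blast
    have nz: "u \<noteq> 0" "w \<noteq> 0"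
      using invariant_openD(1) U W u w by auto
    then obtain k where k: "w = q powi k * u"
      using q_proj_eq_iff[of u w] u w by auto
    show ?thesis
    proof (cases "k \<ge> 0")
      case True
      then have "u = w / q ^ nat k"
        using k q_nonzero by (simp add: power_int_def)
      then show ?thesis
        using invariant_openD(2)[OF W(1) w(1)] u by blast
    next
      case False
      then have "w = u / q ^ nat (- k)"
        using k q_nonzero by (simp add: power_int_def divide_inverse mult.commute power_inverse)
      then show ?thesis
        using invariant_openD(2)[OF U(1) u(1)] w by blast
    qed
  qed
  then have "q_proj q ` (U \<inter> W) = V" using U W by blast
  then show ?thesis
    using U W unfolding invariant_over_def invariant_open_def by auto
qed


section \<open>Asymptotic expansions\<close>

lemma invariant_strict_subset_subset:
  assumes "invariant_open q U" "invariant_strict_subset q U K"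
  shows "K \<subseteq> U"
  using assms invariant_openD(2) unfolding invariant_strict_subset_def by blast

text \<open>A compact subset of \<open>W\<close> is a compact subset of \<open>U\<close>, so there
  are fewer strict subsets to test. Invariance of \<open>W\<close> keeps them inside
  \<open>W\<close>, where \<open>g\<close> and \<open>f\<close> coincide; \<open>g\<close> is
  arbitrary elsewhere, which covers restrictions made \<open>undefined\<close> outside
  \<open>W\<close>.\<close>

lemma q_asymptotic_subset:
  assumes f: "q_asymptotic q U f a" and W: "invariant_open q W" "W \<subseteq> U"
    and eq: "\<And>z. z \<in> W \<Longrightarrow> g z = f z"
  shows "q_asymptotic q W g a"
  unfolding q_asymptotic_def
proof (intro allI impI)
  fix n K assume K: "invariant_strict_subset q W K"
  then have "invariant_strict_subset q U K"
    using W(2) unfolding invariant_strict_subset_def by blast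
  with f have "bounded ((\<lambda>z. (f z - (\<Sum>p<n. fps_nth a p * z ^ p)) / z ^ n) ` K)"
    unfolding q_asymptotic_def by blast
  moreover have "(\<lambda>z. (f z - (\<Sum>p<n. fps_nth a p * z ^ p)) / z ^ n) ` K
      = (\<lambda>z. (g z - (\<Sum>p<n. fps_nth a p * z ^ p)) / z ^ n) ` K"
    using invariant_strict_subset_subset[OF W(1) K] eq by (intro image_cong) auto
  ultimately show "bounded ((\<lambda>z. (g z - (\<Sum>p<n. fps_nth a p * z ^ p)) / z ^ n) ` K)"
    by simp
qed

lemma q_asym_functions_restrict:
  assumes "f \<in> q_asym_functions q U" "invariant_open q W" "W \<subseteq> U"
  shows "restrict f W \<in> q_asym_functions q W"
proof -
  obtain a where a: "q_asymptotic q U f a" and f: "f holomorphic_on U"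
    using assms unfolding q_asym_functions_def by auto
  have "q_asymptotic q W (restrict f W) a"
    by (rule q_asymptotic_subset[OF a]) (use assms in auto)
  moreover have "restrict f W holomorphic_on W"
    using holomorphic_on_subset[OF f assms(3)] by (rule holomorphic_transform) auto
  ultimately show ?thesis
    unfolding q_asym_functions_def by auto
qed

text \<open>The backward orbit of a single point is already a strict subset and tends to 0. Along it
  the coefficients are determined one after the other.\<close>

lemma q_asymptotic_unique:
  assumes U: "invariant_open q U" "z \<in> U"
    and a: "q_asymptotic q U f a" and b: "q_asymptotic q U f b"
  shows "a = b"
proof (rule fps_ext)
  fix n
  show "fps_nth a n = fps_nth b n"
  proof (induction n rule: less_induct)
    case (less n)
    define K where "K = (\<Union>k::nat. (\<lambda>z. z / q ^ k) ` {z})"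
    have K: "invariant_strict_subset q U K"
      unfolding invariant_strict_subset_def K_def using U by (intro exI[of _ "{z}"]) auto
    \<comment> \<open>Order \<open>Suc n\<close> is the first whose remainder involves the
      coefficient of index \<open>n\<close>. Once the lower terms cancel, the two remainders differ
      by a multiple of \<open>1 / w\<close>, which is bounded along the orbit only if that multiple
      is 0.\<close>
    define R where "R c w = (f w - (\<Sum>p<Suc n. fps_nth c p * w ^ p)) / w ^ Suc n" for c w
    have "bounded (R a ` K)" "bounded (R b ` K)"
      using a b K unfolding q_asymptotic_def R_def by blast+
    then obtain A B where A: "\<And>w. w \<in> K \<Longrightarrow> norm (R a w) \<le> A"
      and B: "\<And>w. w \<in> K \<Longrightarrow> norm (R b w) \<le> B"
      unfolding bounded_iff by auto
    define d where "d = norm (fps_nth a n - fps_nth b n)"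
    have z: "z \<noteq> 0" using invariant_openD(1)[OF U] .
    have bound: "d * norm q ^ k \<le> (A + B) * norm z" for k
    proof -
      define w where "w = z / q ^ k"
      have w: "w \<in> K" "w \<noteq> 0" unfolding w_def K_def using z q_nonzero by auto
      have "(\<Sum>p<n. fps_nth a p * w ^ p) = (\<Sum>p<n. fps_nth b p * w ^ p)"
        using less by simp
      then have "R b w - R a w = (fps_nth a n - fps_nth b n) / w"
        unfolding R_def using w by (simp add: field_simps)
      then have "d / norm w \<le> A + B"
        using norm_triangle_ineq4[of "R b w" "R a w"] A[OF w(1)] B[OF w(1)]
        by (simp add: d_def norm_divide)
      then show ?thesis
        using z q_nonzero by (simp add: w_def norm_divide norm_power field_simps)
    qed
    have "d = 0"
    proof (rule ccontr)
      assume "d \<noteq> 0"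
      then have "d > 0" by (simp add: d_def)
      obtain k where "(A + B) * norm z / d < norm q ^ k"
        using real_arch_pow[OF q] by blast
      with bound[of k] \<open>d > 0\<close> show False by (simp add: field_simps)
    qed
    then show ?case by (simp add: d_def)
  qed
qed


section \<open>The presheaf of germs at the origin\<close>

text \<open>Transitivity rests on \<open>invariant_over_Int\<close>: the two sets of agreement must
  have a common refinement that still lies over all of \<open>V\<close>, that is, the limit must be
  directed.\<close>

lemma equiv_q_asym_rel: "equiv (q_asym_pairs q V) (q_asym_rel q V)"
proof (rule equivI)
  show "refl_on (q_asym_pairs q V) (q_asym_rel q V)"
    unfolding refl_on_def q_asym_rel_def by (auto simp: q_asym_pairs_def)
  show "q_asym_rel q V \<subseteq> q_asym_pairs q V \<times> q_asym_pairs q V"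
    unfolding q_asym_rel_def by auto
  show "sym (q_asym_rel q V)"
  proof (rule symI, clarify)
    fix U f U' f'
    assume "((U, f), U', f') \<in> q_asym_rel q V"
    then obtain W where "W \<in> invariant_over q V" "W \<subseteq> U' \<inter> U" "restrict f' W = restrict f W"
      "(U, f) \<in> q_asym_pairs q V" "(U', f') \<in> q_asym_pairs q V"
      unfolding q_asym_rel_def by fastforce
    then show "((U', f'), U, f) \<in> q_asym_rel q V"
      unfolding q_asym_rel_def by blast
  qed
  show "trans (q_asym_rel q V)"
  proof (rule transI, clarify)
    fix U f U' f' U'' f''
    assume 1: "((U, f), U', f') \<in> q_asym_rel q V" and 2: "((U', f'), U'', f'') \<in> q_asym_rel q V"
    then obtain W W' where W: "W \<in> invariant_over q V" "W \<subseteq> U \<inter> U'" "restrict f W = restrict f' W"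
      and W': "W' \<in> invariant_over q V" "W' \<subseteq> U' \<inter> U''" "restrict f' W' = restrict f'' W'"
      unfolding q_asym_rel_def by blast
    have "restrict f (W \<inter> W') = restrict f'' (W \<inter> W')"
      using arg_cong[OF W(3), of "\<lambda>g. restrict g W'"] arg_cong[OF W'(3), of "\<lambda>g. restrict g W"]
      by (simp add: Int_commute)
    with W W' 1 2 show "((U, f), U'', f'') \<in> q_asym_rel q V"
      unfolding q_asym_rel_def
      by (auto intro!: bexI[of _ "W \<inter> W'"] invariant_over_Int)
  qed
qed

lemma q_asym_pairs_restrict:
  assumes "(U, f) \<in> q_asym_pairs q V" "openin (E_q q) V'" "V' \<subseteq> V"
  shows "(U \<inter> q_proj q -` V', restrict f (U \<inter> q_proj q -` V')) \<in> q_asym_pairs q V'"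
  using assms invariant_over_Int_vimage[of U V V']
  by (auto simp: q_asym_pairs_def invariant_over_def intro!: q_asym_functions_restrict)

lemma q_asym_rel_restrict:
  assumes rel: "((U, f), (U', f')) \<in> q_asym_rel q V" and V': "openin (E_q q) V'" "V' \<subseteq> V"
  shows "((U \<inter> q_proj q -` V', restrict f (U \<inter> q_proj q -` V')),
          (U' \<inter> q_proj q -` V', restrict f' (U' \<inter> q_proj q -` V'))) \<in> q_asym_rel q V'"
proof -
  obtain W where W: "W \<in> invariant_over q V" "W \<subseteq> U \<inter> U'" "restrict f W = restrict f' W"
    and pairs: "(U, f) \<in> q_asym_pairs q V" "(U', f') \<in> q_asym_pairs q V"
    using rel unfolding q_asym_rel_def by blast
  define W' where "W' = W \<inter> q_proj q -` V'"
  have eq: "f z = f' z" if "z \<in> W" for z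
    using W(3) that by (metis restrict_apply')
  have "W' \<in> invariant_over q V'"
    unfolding W'_def by (rule invariant_over_Int_vimage) fact+
  moreover have "restrict (restrict f (U \<inter> q_proj q -` V')) W'
      = restrict (restrict f' (U' \<inter> q_proj q -` V')) W'"
    using W(2) eq by (intro ext) (auto simp: W'_def restrict_def)
  moreover have "W' \<subseteq> (U \<inter> q_proj q -` V') \<inter> (U' \<inter> q_proj q -` V')"
    using W(2) by (auto simp: W'_def)
  ultimately have "\<exists>W \<in> invariant_over q V'. W \<subseteq> (U \<inter> q_proj q -` V') \<inter> (U' \<inter> q_proj q -` V') \<and>
      restrict (restrict f (U \<inter> q_proj q -` V')) W = restrict (restrict f' (U' \<inter> q_proj q -` V')) W"
    by blast
  then show ?thesis
    using q_asym_pairs_restrict[OF pairs(1) V'] q_asym_pairs_restrict[OF pairs(2) V']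
    by (simp only: q_asym_rel_def mem_Collect_eq prod.case simp_thms)
qed

text \<open>The union in \<open>Res\<close> ranges over equal classes by
  \<open>q_asym_rel_restrict\<close>, so it collapses and restriction can be computed on any
  representative.\<close>

lemma Res_q_asym_class:
  assumes "(U, f) \<in> q_asym_pairs q V" "openin (E_q q) V'" "V' \<subseteq> V"
  shows "Res (q_asym_presheaf q) V V' (q_asym_rel q V `` {(U, f)})
    = q_asym_rel q V' `` {(U \<inter> q_proj q -` V', restrict f (U \<inter> q_proj q -` V'))}"
proof -
  have "(\<lambda>(U, f). q_asym_rel q V' `` {(U \<inter> q_proj q -` V', restrict f (U \<inter> q_proj q -` V'))})
      respects q_asym_rel q V"
    using q_asym_rel_restrict[OF _ assms(2,3)]
    by (intro congruentI) (auto intro!: equiv_class_eq[OF equiv_q_asym_rel])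
  from UN_equiv_class[OF equiv_q_asym_rel this assms(1)] show ?thesis
    by (simp add: q_asym_presheaf_def)
qed

lemma q_asym_class_cases:
  assumes "s \<in> Sec (q_asym_presheaf q) V"
  obtains U f where "(U, f) \<in> q_asym_pairs q V" "s = q_asym_rel q V `` {(U, f)}"
  using assms unfolding q_asym_presheaf_def by (auto elim!: quotientE)

lemma q_asym_class_in_Sec:
  assumes "(U, f) \<in> q_asym_pairs q V"
  shows "q_asym_rel q V `` {(U, f)} \<in> Sec (q_asym_presheaf q) V"
  using assms unfolding q_asym_presheaf_def by (auto intro: quotientI)

lemma presheaf_q_asym_presheaf: "presheaf (E_q q) (q_asym_presheaf q)"
proof
  fix U V s
  assume "openin (E_q q) V" "V \<subseteq> U" "s \<in> Sec (q_asym_presheaf q) U"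
  then show "Res (q_asym_presheaf q) U V s \<in> Sec (q_asym_presheaf q) V"
    by (elim q_asym_class_cases)
       (auto simp: Res_q_asym_class intro!: q_asym_class_in_Sec q_asym_pairs_restrict)
next
  fix V s
  assume V: "openin (E_q q) V" and "s \<in> Sec (q_asym_presheaf q) V"
  then obtain U f where Uf: "(U, f) \<in> q_asym_pairs q V" "s = q_asym_rel q V `` {(U, f)}"
    by (elim q_asym_class_cases)
  \<comment> \<open>As \<open>U\<close> projects onto \<open>V\<close>, restricting the
    representative to the preimage of \<open>V\<close> changes neither its domain nor, by
    extensionality, the function.\<close>
  then have "U \<inter> q_proj q -` V = U" "f \<in> extensional U"
    unfolding q_asym_pairs_def invariant_over_def q_asym_functions_def by auto
  with Uf V show "Res (q_asym_presheaf q) V V s = s"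
    by (simp add: Res_q_asym_class extensional_restrict)
next
  fix V V' V'' s
  assume V: "openin (E_q q) V" "openin (E_q q) V'" "openin (E_q q) V''" "V'' \<subseteq> V'" "V' \<subseteq> V"
    and "s \<in> Sec (q_asym_presheaf q) V"
  then obtain U f where Uf: "(U, f) \<in> q_asym_pairs q V" "s = q_asym_rel q V `` {(U, f)}"
    by (elim q_asym_class_cases)
  have "U \<inter> q_proj q -` V' \<inter> q_proj q -` V'' = U \<inter> q_proj q -` V''"
    "U \<inter> q_proj q -` V' \<inter> (U \<inter> q_proj q -` V'') = U \<inter> q_proj q -` V''"
    using V by auto
  with Uf V q_asym_pairs_restrict[OF Uf(1) V(2,5)]
  show "Res (q_asym_presheaf q) V' V'' (Res (q_asym_presheaf q) V V' s)
      = Res (q_asym_presheaf q) V V'' s"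
    by (auto simp: Res_q_asym_class)
qed


section \<open>The expansion morphism\<close>

text \<open>Two representatives agree on some \<open>W\<close> over \<open>V\<close>, and both
  expansions are expansions of \<open>f\<close> there. Since \<open>V\<close> is nonempty,
  \<open>W\<close> has a point, so \<open>q_asymptotic_unique\<close> applies.\<close>

lemma q_expansion_class:
  assumes Uf: "(U, f) \<in> q_asym_pairs q V" and ne: "V \<noteq> {}" and a: "q_asymptotic q U f a"
  shows "q_expansion q (q_asym_rel q V `` {(U, f)}) = a"
  unfolding q_expansion_def
proof (rule the_equality)
  show "\<exists>(U', f')\<in>q_asym_rel q V `` {(U, f)}. q_asymptotic q U' f' a"
    using a equiv_class_self[OF equiv_q_asym_rel Uf] by blast
next
  fix b
  assume "\<exists>(U', f')\<in>q_asym_rel q V `` {(U, f)}. q_asymptotic q U' f' b"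
  then obtain U' f' W where b: "q_asymptotic q U' f' b"
    and W: "W \<in> invariant_over q V" "W \<subseteq> U \<inter> U'" "restrict f W = restrict f' W"
    unfolding q_asym_rel_def by blast
  then obtain w where w: "w \<in> W" "invariant_open q W"
    using ne unfolding invariant_over_def by auto
  have "q_asymptotic q W f a"
    using a by (rule q_asymptotic_subset) (use w W in auto)
  moreover have "q_asymptotic q W f b"
    using b by (rule q_asymptotic_subset) (use w W in \<open>auto, metis restrict_apply'\<close>)
  ultimately show "b = a"
    using q_asymptotic_unique w by blast
qed

lemma q_expansion_Res:
  assumes s: "s \<in> Sec (q_asym_presheaf q) V" and V': "openin (E_q q) V'" "V' \<subseteq> V" "V' \<noteq> {}"
  shows "q_expansion q (Res (q_asym_presheaf q) V V' s) = q_expansion q s"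
proof -
  obtain U f where Uf: "(U, f) \<in> q_asym_pairs q V" "s = q_asym_rel q V `` {(U, f)}"
    using s by (elim q_asym_class_cases)
  then obtain a where a: "q_asymptotic q U f a"
    unfolding q_asym_pairs_def q_asym_functions_def by auto
  have inv: "invariant_open q (U \<inter> q_proj q -` V')"
    using invariant_over_Int_vimage[of U V V'] Uf V'
    unfolding q_asym_pairs_def invariant_over_def by auto
  have "q_asymptotic q (U \<inter> q_proj q -` V') (restrict f (U \<inter> q_proj q -` V')) a"
    by (rule q_asymptotic_subset[OF a inv]) auto
  then show ?thesis
    using Uf V' a q_expansion_class[OF q_asym_pairs_restrict[OF Uf(1) V'(1,2)]]
      q_expansion_class[OF Uf(1)] by (auto simp: Res_q_asym_class)
qed

text \<open>Any two members of a germ at \<open>x\<close> have the same restriction to some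
  neighbourhood of \<open>x\<close>. This is nonempty, so by \<open>q_expansion_Res\<close> their
  expansions coincide.\<close>

lemma q_germ_expansion_germ:
  assumes V: "openin (E_q q) V" "x \<in> V" and s: "s \<in> Sec (q_asym_presheaf q) V"
  shows "q_germ_expansion q (germ (E_q q) (q_asym_presheaf q) x V s) = q_expansion q s"
  unfolding q_germ_expansion_def
proof (rule the_equality)
  have "(V, s) \<in> germ (E_q q) (q_asym_presheaf q) x V s"
    unfolding germ_def using assms by auto
  then show "\<exists>(V', t)\<in>germ (E_q q) (q_asym_presheaf q) x V s. q_expansion q s = q_expansion q t"
    by blast
next
  fix b
  assume "\<exists>(V', t)\<in>germ (E_q q) (q_asym_presheaf q) x V s. b = q_expansion q t"
  then obtain V' t W where t: "b = q_expansion q t" "t \<in> Sec (q_asym_presheaf q) V'"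
    and W: "openin (E_q q) W" "x \<in> W" "W \<subseteq> V \<inter> V'"
      "Res (q_asym_presheaf q) V W s = Res (q_asym_presheaf q) V' W t"
    unfolding germ_def by blast
  show "b = q_expansion q s"
    using q_expansion_Res[OF s W(1)] q_expansion_Res[OF t(2) W(1)] W t(1) by auto
qed

lemma Sec_q_asym_sheaf:
  "Sec (q_asym_sheaf q) U = {\<sigma> \<in> extensional U. \<forall>x\<in>U. \<exists>V s.
      openin (E_q q) V \<and> x \<in> V \<and> V \<subseteq> U \<and> s \<in> Sec (q_asym_presheaf q) V \<and>
      (\<forall>y\<in>V. \<sigma> y = germ (E_q q) (q_asym_presheaf q) y V s)}"
  unfolding q_asym_sheaf_def sheafification_def by simp

lemma sheaf_morphism_q_expansion:
  "sheaf_morphism (E_q q) (q_asym_sheaf q) (constant_sheaf (E_q q)) (q_expansion_morphism q)"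
proof -
  interpret F: sheaf "E_q q" "q_asym_sheaf q"
    unfolding q_asym_sheaf_def
    by (rule presheaf.sheaf_sheafification[OF presheaf_q_asym_presheaf])
  interpret G: sheaf "E_q q"
    "constant_sheaf (E_q q) :: (complex set, complex set \<Rightarrow> complex fps) presheaf_data"
    by (rule sheaf_constant_sheaf)
  show ?thesis
  proof
    fix U \<sigma> assume "openin (E_q q) U" and \<sigma>: "\<sigma> \<in> Sec (q_asym_sheaf q) U"
    have "\<exists>V. openin (E_q q) V \<and> x \<in> V \<and> V \<subseteq> U \<and>
        (\<forall>y\<in>V. q_expansion_morphism q U \<sigma> y = q_expansion_morphism q U \<sigma> x)" if "x \<in> U" for x
    proof -
      have "\<exists>V s. openin (E_q q) V \<and> x \<in> V \<and> V \<subseteq> U \<and> s \<in> Sec (q_asym_presheaf q) V \<and>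
          (\<forall>y\<in>V. \<sigma> y = germ (E_q q) (q_asym_presheaf q) y V s)"
        using \<sigma> that unfolding Sec_q_asym_sheaf by simp
      then obtain V s where V: "openin (E_q q) V" "x \<in> V" "V \<subseteq> U"
        and s: "s \<in> Sec (q_asym_presheaf q) V"
        and eq: "\<And>y. y \<in> V \<Longrightarrow> \<sigma> y = germ (E_q q) (q_asym_presheaf q) y V s"
        by auto
      \<comment> \<open>Where \<sigma> comes from a single section \<open>s\<close>, all germs share
        the expansion of \<open>s\<close>; this is local constancy of the image.\<close>
      have "q_expansion_morphism q U \<sigma> y = q_expansion q s" if "y \<in> V" for y
        using that V eq q_germ_expansion_germ[OF V(1) that s]
        by (auto simp: q_expansion_morphism_def)
      with V show ?thesis by auto
    qed
    moreover have "q_expansion_morphism q U \<sigma> \<in> extensional U"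
      unfolding q_expansion_morphism_def by simp
    ultimately show "q_expansion_morphism q U \<sigma> \<in> Sec (constant_sheaf (E_q q)) U"
      unfolding constant_sheaf_def by (simp only: presheaf_data.simps mem_Collect_eq) blast
  next
    fix U V :: "complex set set" and \<sigma> assume "V \<subseteq> U"
    then show "Res (constant_sheaf (E_q q)) U V (q_expansion_morphism q U \<sigma>)
        = q_expansion_morphism q V (Res (q_asym_sheaf q) U V \<sigma>)"
      by (intro ext) (auto simp: constant_sheaf_def q_asym_sheaf_def sheafification_def
          q_expansion_morphism_def restrict_def)
  qed
qed


section \<open>Local realization of a formal power series\<close>

lemma ex_slow_truncation:
  fixes A :: "nat \<Rightarrow> real"
  assumes A: "A 0 = 0" and s: "1 < s"
  obtains N :: "nat \<Rightarrow> nat" where "\<And>k. A (N k) \<le> s ^ k" "\<And>n. \<exists>k0. \<forall>k\<ge>k0. n \<le> N k"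
proof
  \<comment> \<open>The cap \<open>n \<le> k\<close> makes the set finite even if \<open>A\<close>
    is bounded, and \<open>A 0 = 0\<close> makes it nonempty. Each fixed \<open>n\<close> is
    admissible for all large \<open>k\<close>, because \<open>s ^ k\<close> eventually passes
    \<open>A n\<close>.\<close>
  define N where "N k = Max {n. n \<le> k \<and> A n \<le> s ^ k}" for k
  have "N k \<in> {n. n \<le> k \<and> A n \<le> s ^ k}" for k
    unfolding N_def
  proof (rule Max_in)
    have "0 \<in> {n. n \<le> k \<and> A n \<le> s ^ k}"
      using A s by simp
    then show "{n. n \<le> k \<and> A n \<le> s ^ k} \<noteq> {}" by blast
  qed auto
  then show "A (N k) \<le> s ^ k" for k by blast
  fix n
  obtain m where m: "A n < s ^ m"
    using real_arch_pow[OF s] by blast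
  have "n \<le> N k" if "k \<ge> max m n" for k
  proof -
    have "s ^ m \<le> s ^ k" using that s by (intro power_increasing) auto
    with m that show ?thesis
      unfolding N_def by (intro Max_ge) auto
  qed
  then show "\<exists>k0. \<forall>k\<ge>k0. n \<le> N k" by blast
qed

text \<open>Every term beyond index \<open>n\<close> contains at least one more factor
  \<open>z\<close> than \<open>z ^ n\<close>; by \<open>small\<close>, that spare factor absorbs the
  sum of all the coefficients.\<close>

lemma norm_truncation_diff_le:
  fixes a :: "nat \<Rightarrow> complex" and z :: complex
  assumes n: "n \<le> N" and z: "norm z \<le> 1" and small: "(\<Sum>p<N. norm (a p)) * norm z \<le> 1"
  shows "norm ((\<Sum>p<N. a p * z ^ p) - (\<Sum>p<n. a p * z ^ p)) \<le> (norm (a n) + 1) * norm z ^ n"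
proof (cases "n = N")
  case False
  with n have n: "n < N" by simp
  have split: "{..<N} = {..<n} \<union> {n} \<union> {n<..<N}" using n by auto
  have "(\<Sum>p<N. a p * z ^ p)
      = (\<Sum>p<n. a p * z ^ p) + a n * z ^ n + (\<Sum>p\<in>{n<..<N}. a p * z ^ p)"
    unfolding split by (subst sum.union_disjoint; auto)+
  then have "norm ((\<Sum>p<N. a p * z ^ p) - (\<Sum>p<n. a p * z ^ p))
      = norm (a n * z ^ n + (\<Sum>p\<in>{n<..<N}. a p * z ^ p))" by simp
  also have "\<dots> \<le> norm (a n) * norm z ^ n + norm (\<Sum>p\<in>{n<..<N}. a p * z ^ p)"
    by (metis norm_triangle_ineq norm_mult norm_power)
  also have "norm (\<Sum>p\<in>{n<..<N}. a p * z ^ p) \<le> (\<Sum>p\<in>{n<..<N}. norm (a p) * norm z ^ Suc n)"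
  proof (rule sum_norm_le)
    fix p assume "p \<in> {n<..<N}"
    then have "norm z ^ p \<le> norm z ^ Suc n"
      using z by (intro power_decreasing) auto
    then show "norm (a p * z ^ p) \<le> norm (a p) * norm z ^ Suc n"
      by (simp add: norm_mult norm_power mult_left_mono del: power_Suc)
  qed
  also have "\<dots> = (\<Sum>p\<in>{n<..<N}. norm (a p)) * norm z ^ Suc n"
    by (simp add: sum_distrib_right)
  also have "\<dots> \<le> (\<Sum>p<N. norm (a p)) * norm z ^ Suc n"
    by (intro mult_right_mono sum_mono2) auto
  also have "\<dots> = (\<Sum>p<N. norm (a p)) * norm z * norm z ^ n" by simp
  also have "\<dots> \<le> 1 * norm z ^ n"
    using small by (intro mult_right_mono) auto
  finally show ?thesis by (simp add: algebra_simps)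
qed simp

text \<open>Meant for the finitely many discs on which the truncation is still shorter than
  \<open>n\<close>: there \<open>z\<close> stays away from 0, and a crude bound independent of
  \<open>z\<close> is enough.\<close>

lemma norm_truncation_diff_le_coeffs:
  fixes a :: "nat \<Rightarrow> complex" and z :: complex
  assumes n: "N \<le> n" and z: "norm z \<le> 1"
  shows "norm ((\<Sum>p<N. a p * z ^ p) - (\<Sum>p<n. a p * z ^ p)) \<le> (\<Sum>p<n. norm (a p))"
proof -
  have "(\<Sum>p<n. a p * z ^ p) - (\<Sum>p<N. a p * z ^ p) = (\<Sum>p\<in>{..<n} - {..<N}. a p * z ^ p)"
    using n by (subst sum_diff) auto
  then have "norm ((\<Sum>p<N. a p * z ^ p) - (\<Sum>p<n. a p * z ^ p))
      = norm (\<Sum>p\<in>{..<n} - {..<N}. a p * z ^ p)"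
    by (metis norm_minus_commute)
  also have "\<dots> \<le> (\<Sum>p\<in>{..<n} - {..<N}. norm (a p))"
    using z by (intro sum_norm_le)
      (auto simp: norm_mult norm_power intro!: mult_left_le power_le_one)
  also have "\<dots> \<le> (\<Sum>p<n. norm (a p))"
    by (intro sum_mono2) auto
  finally show ?thesis .
qed

lemma ex_local_q_asymptotic:
  fixes a :: "complex fps"
  assumes Y: "openin (E_q q) Y" "x \<in> Y"
  shows "\<exists>V U f. openin (E_q q) V \<and> x \<in> V \<and> V \<subseteq> Y \<and> (U, f) \<in> q_asym_pairs q V \<and>
    q_asymptotic q U f a"
proof -
  define s where "s = norm q"
  have s: "1 < s" using q by (simp add: s_def)
  obtain z1 where z1: "z1 \<noteq> 0" "x = q_proj q z1"
    using Y unfolding openin_E_q q_proj_def quotient_def by auto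
  obtain m where m: "norm z1 < s ^ m"
    using real_arch_pow[OF s] by blast
  \<comment> \<open>A representative inside the unit disc leaves room for a disc around it in the
    region \<open>norm z \<le> 1\<close> required by the truncation estimates.\<close>
  define z0 where "z0 = z1 / q ^ m"
  have z0: "z0 \<noteq> 0" "x = q_proj q z0" "norm z0 < 1"
    using z1 q_nonzero m s q_proj_divide_power[OF z1(1), of m]
    by (auto simp: z0_def norm_divide norm_power s_def)
  have "open {z \<in> - {0}. q_proj q z \<in> Y}" "z0 \<in> {z \<in> - {0}. q_proj q z \<in> Y}"
    using Y z0 unfolding openin_E_q by auto
  then obtain e where e: "e > 0" "ball z0 e \<subseteq> {z \<in> - {0}. q_proj q z \<in> Y}"
    using open_contains_ball by blast
  \<comment> \<open>The three bounds keep the disc in the preimage of \<open>Y\<close>, keep it in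
    the unit disc, and give \<open>norm z0 + r \<le> s * (norm z0 - r)\<close>, which makes its
    images under powers of \<open>q\<close> disjoint.\<close>
  define r where "r = min (min e (1 - norm z0)) (norm z0 * (s - 1) / (s + 1))"
  define c where "c = norm z0 - r"
  have "r \<le> norm z0 * (s - 1) / (s + 1)"
    unfolding r_def by simp
  then have "r * (s + 1) \<le> norm z0 * (s - 1)"
    using s by (simp add: pos_le_divide_eq)
  then have rc: "norm z0 + r \<le> s * c"
    by (simp add: c_def algebra_simps)
  have r: "r > 0" "r \<le> e" "norm z0 + r \<le> 1"
    using e z0 s by (auto simp: r_def)
  have c: "c > 0"
  proof -
    have "0 < s * c" using rc r z0 by (smt (verit) norm_ge_zero)
    then show ?thesis using s by (simp add: zero_less_mult_iff)
  qed
  define D where "D k = (\<lambda>z. z * q ^ k) -` ball z0 r" for k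
  define U where "U = (\<Union>k. D k)"
  have D_open: "open (D k)" for k
    unfolding D_def by (intro open_vimage continuous_intros open_ball)
  have D_norm: "c < norm z * s ^ k" "norm z * s ^ k < norm z0 + r" if "z \<in> D k" for z k
  proof -
    have "norm (z * q ^ k - z0) < r"
      using that by (simp add: D_def dist_norm norm_minus_commute)
    then show "c < norm z * s ^ k" "norm z * s ^ k < norm z0 + r"
      unfolding c_def s_def norm_power[symmetric] norm_mult[symmetric] by norm+
  qed
  \<comment> \<open>By \<open>rc\<close>, \<open>D k\<close> lies in the annulus where
    \<open>norm z * s ^ k\<close> is strictly between \<open>c\<close> and \<open>s * c\<close>;
    these annuli are disjoint for distinct \<open>k\<close>.\<close>
  have not_less: "\<not> j < k" if "z \<in> D j" "z \<in> D k" for z j k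
  proof
    assume "j < k"
    then have "s ^ Suc j \<le> s ^ k" using s by (intro power_increasing) auto
    then have "norm z * s ^ j * s \<le> norm z * s ^ k"
      by (simp add: mult_left_mono mult.assoc mult.commute[of s])
    moreover have "c * s < norm z * s ^ j * s"
      using D_norm[OF that(1)] s by simp
    ultimately show False
      using D_norm[OF that(2)] rc by (simp add: mult.commute)
  qed
  define \<kappa> where "\<kappa> z = (SOME k. z \<in> D k)" for z
  have \<kappa>: "\<kappa> z = k" if "z \<in> D k" for z k
    using someI[of "\<lambda>k. z \<in> D k", OF that] not_less[OF that] not_less[OF _ that]
    unfolding \<kappa>_def by (meson linorder_neqE_nat)
  have D_small: "norm z \<le> 1" "norm z * s ^ k \<le> 1" if "z \<in> D k" for z k
  proof -
    show "norm z * s ^ k \<le> 1" using D_norm[OF that] r by simp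
    moreover have "norm z * 1 \<le> norm z * s ^ k"
      using s by (intro mult_left_mono) auto
    ultimately show "norm z \<le> 1" by simp
  qed
  have U_nz: "0 \<notin> U"
    using D_norm(1)[of 0] c unfolding U_def by fastforce
  have U_open: "open U" unfolding U_def using D_open by blast
  have "z / q \<in> U" if "z \<in> U" for z
  proof -
    from that obtain k where "z \<in> D k" unfolding U_def by blast
    then have "z / q \<in> D (Suc k)" using q_nonzero by (simp add: D_def)
    then show ?thesis unfolding U_def by blast
  qed
  with U_open U_nz have U_inv: "invariant_open q U"
    unfolding invariant_open_def by blast
  define S where "S n z = (\<Sum>p<n. fps_nth a p * z ^ p)" for n z
  define A where "A n = (\<Sum>p<n. norm (fps_nth a p))" for n
  obtain N where N: "\<And>k. A (N k) \<le> s ^ k" "\<And>n. \<exists>k0. \<forall>k\<ge>k0. n \<le> N k"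
    using ex_slow_truncation[of A s] s by (auto simp: A_def)
  define f where "f = (\<lambda>z\<in>U. S (N (\<kappa> z)) z)"
  have f_eq: "f z = S (N k) z" if "z \<in> D k" for z k
    using that \<kappa>[OF that] unfolding f_def U_def by auto
  have hol: "f holomorphic_on U"
    unfolding U_def
  proof (rule holomorphic_on_UN_open)
    fix k
    have "S (N k) holomorphic_on D k"
      unfolding S_def by (intro holomorphic_intros)
    then show "f holomorphic_on D k"
      by (rule holomorphic_transform) (simp add: f_eq)
  qed (use D_open in auto)
  have asym: "q_asymptotic q U f a"
    unfolding q_asymptotic_def
  proof (intro allI impI)
    fix n K assume K: "invariant_strict_subset q U K"
    obtain k0 where k0: "\<And>k. k \<ge> k0 \<Longrightarrow> n \<le> N k" using N(2) by blast
    \<comment> \<open>The first entry serves the discs with \<open>n \<le> N k\<close>. All others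
      have \<open>k \<le> k0\<close>, hence \<open>norm z \<ge> c / s ^ k0\<close>, and are served
      by the second. The bound holds on all of \<open>U\<close>, so \<open>K\<close> enters only
      through \<open>K \<subseteq> U\<close>.\<close>
    define B where "B = max (norm (fps_nth a n) + 1) (A n / (c / s ^ k0) ^ n)"
    have "norm ((f z - S n z) / z ^ n) \<le> B" if z: "z \<in> U" for z
    proof -
      obtain k where k: "z \<in> D k" using z unfolding U_def by blast
      have nz: "norm z > 0" using z U_nz by auto
      show ?thesis
      proof (cases "n \<le> N k")
        case True
        \<comment> \<open>Together with \<open>norm z * s ^ k \<le> 1\<close> on \<open>D k\<close>,
          the slow growth of \<open>N\<close> yields the smallness hypothesis of
          \<open>norm_truncation_diff_le\<close>.\<close>
        have "A (N k) * norm z \<le> s ^ k * norm z"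
          using N(1) by (intro mult_right_mono) auto
        then have "norm (S (N k) z - S n z) \<le> (norm (fps_nth a n) + 1) * norm z ^ n"
          unfolding S_def A_def
          by (intro norm_truncation_diff_le[OF True D_small(1)[OF k]])
             (use D_small(2)[OF k] in \<open>simp add: mult.commute\<close>)
        then have "norm ((f z - S n z) / z ^ n) \<le> norm (fps_nth a n) + 1"
          using nz by (simp add: f_eq[OF k] norm_divide norm_power divide_le_eq)
        then show ?thesis by (simp add: B_def)
      next
        case False
        then have "k \<le> k0" using k0 by (meson nle_le)
        then have "s ^ k \<le> s ^ k0" using s by (intro power_increasing) auto
        then have "norm z * s ^ k \<le> norm z * s ^ k0" by (intro mult_left_mono) auto
        then have "c / s ^ k0 \<le> norm z"
          using D_norm(1)[OF k] s by (simp add: divide_le_eq)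
        then have lower: "(c / s ^ k0) ^ n \<le> norm z ^ n"
          using c s by (intro power_mono) auto
        have "norm (S (N k) z - S n z) \<le> A n"
          unfolding S_def A_def using False D_small(1)[OF k]
          by (intro norm_truncation_diff_le_coeffs) auto
        then have "norm ((f z - S n z) / z ^ n) \<le> A n / norm z ^ n"
          by (simp add: f_eq[OF k] norm_divide norm_power divide_right_mono)
        also have "\<dots> \<le> A n / (c / s ^ k0) ^ n"
          using lower c s zero_less_power[OF nz, of n]
          by (intro divide_left_mono) (auto simp: A_def sum_nonneg intro!: mult_pos_pos)
        finally show ?thesis by (simp add: B_def)
      qed
    qed
    with invariant_strict_subset_subset[OF U_inv K]
    show "bounded ((\<lambda>z. (f z - (\<Sum>p<n. fps_nth a p * z ^ p)) / z ^ n) ` K)"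
      unfolding bounded_iff S_def by blast
  qed
  have "z0 \<in> D 0" using r by (simp add: D_def)
  then have "x \<in> q_proj q ` U" using z0 unfolding U_def by blast
  moreover have "q_proj q ` U \<subseteq> Y"
  proof clarify
    fix z assume z: "z \<in> U"
    then obtain k where k: "z \<in> D k" unfolding U_def by blast
    then have "z * q ^ k \<in> ball z0 e"
      using r(2) by (simp add: D_def)
    then have "z * q ^ k \<noteq> 0" "q_proj q (z * q ^ k) \<in> Y"
      using e(2) by blast+
    with q_proj_divide_power[of "z * q ^ k" k] show "q_proj q z \<in> Y"
      using q_nonzero by simp
  qed
  moreover have "(U, f) \<in> q_asym_pairs q (q_proj q ` U)"
    using U_inv hol asym
    unfolding q_asym_pairs_def invariant_over_def q_asym_functions_def
    by (auto simp: f_def)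
  ultimately show ?thesis
    using asym openin_q_proj_image[OF U_open U_nz] by blast
qed

text \<open>Near \<open>x\<close> the section \<open>t\<close> is constant, so a single series
  \<open>t x\<close> has to be realized. The lift consists of the germs of the class of the function
  provided by \<open>ex_local_q_asymptotic\<close>.\<close>

lemma q_expansion_morphism_locally_surjective:
  assumes Y: "openin (E_q q) Y" and t: "t \<in> Sec (constant_sheaf (E_q q)) Y" and x: "x \<in> Y"
  shows "\<exists>V \<sigma>. openin (E_q q) V \<and> x \<in> V \<and> V \<subseteq> Y \<and> \<sigma> \<in> Sec (q_asym_sheaf q) V \<and>
    q_expansion_morphism q V \<sigma> = Res (constant_sheaf (E_q q)) Y V t"
proof -
  have "\<forall>x\<in>Y. \<exists>V. openin (E_q q) V \<and> x \<in> V \<and> V \<subseteq> Y \<and> (\<forall>y\<in>V. t y = t x)"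
    using t unfolding constant_sheaf_def presheaf_data.simps mem_Collect_eq by (rule conjunct2)
  with x obtain Y' where Y': "openin (E_q q) Y'" "x \<in> Y'" "Y' \<subseteq> Y" "\<forall>y\<in>Y'. t y = t x"
    by blast
  obtain V U f where V: "openin (E_q q) V" "x \<in> V" "V \<subseteq> Y'"
    and Uf: "(U, f) \<in> q_asym_pairs q V" and f: "q_asymptotic q U f (t x)"
    using ex_local_q_asymptotic[OF Y'(1,2)] by metis
  define s where "s = q_asym_rel q V `` {(U, f)}"
  have s: "s \<in> Sec (q_asym_presheaf q) V"
    unfolding s_def by (rule q_asym_class_in_Sec) fact
  have s_exp: "q_expansion q s = t x"
    unfolding s_def using V by (intro q_expansion_class[OF Uf _ f]) auto
  define \<sigma> where "\<sigma> = (\<lambda>y\<in>V. germ (E_q q) (q_asym_presheaf q) y V s)"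
  have "\<sigma> \<in> Sec (q_asym_sheaf q) V"
    unfolding Sec_q_asym_sheaf using V s by (auto simp: \<sigma>_def intro!: exI[of _ V])
  moreover have "q_expansion_morphism q V \<sigma> = Res (constant_sheaf (E_q q)) Y V t"
  proof -
    have "q_germ_expansion q (\<sigma> y) = t y" if "y \<in> V" for y
    proof -
      have "q_germ_expansion q (\<sigma> y) = t x"
        using q_germ_expansion_germ[OF V(1) that s] s_exp that by (simp add: \<sigma>_def)
      also have "\<dots> = t y"
        using V(3) Y'(4) that by (metis subsetD)
      finally show ?thesis .
    qed
    then have "restrict (\<lambda>y. q_germ_expansion q (\<sigma> y)) V = restrict t V"
      by (rule restrict_ext)
    then show ?thesis
      by (simp only: q_expansion_morphism_def constant_sheaf_def presheaf_data.simps)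
  qed
  ultimately show ?thesis using V Y' by blast
qed

end

theorem theorem4p1p4:
  fixes q :: complex
  assumes "1 < norm q"
  shows "sheaf_epimorphism TYPE('c) (E_q q)
           (q_asym_sheaf q)
           (constant_sheaf (E_q q) :: (complex set, complex set \<Rightarrow> complex fps) presheaf_data)
           (q_expansion_morphism q)"
  by (rule sheaf_epimorphism_if_locally_surjective[OF sheaf_morphism_q_expansion[OF assms]
        q_expansion_morphism_locally_surjective[OF assms]])

end
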